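(* Let $p$ be an odd prime, let $N_{p-2}$ be the number of permutations of $p-2$ letters with an even number of ascents, and let $A=\frac{pB_{p-1}+1}{p}\in\mathbb{Z}_p$ be the Agoh–Giuga quotient. Then (i) $\displaystyle\sum_{\substack{x=1\\ x\text{ odd}}}^{p-1}x^{p-2}\equiv(2N_{p-2})_0-1+p\Bigl(A+(2N_{p-2})_1-\bigl((2N_{p-2})_0-1\bigr)^2-2\Bigr)\pmod{p^2}$; (ii) $\displaystyle\sum_{\substack{x=1\\ x\text{ odd}}}^{p-1}x^{p-1}\equiv-\frac12+\frac p2\Bigl(A-(2N_{p-2})_0+1\Bigr)\pmod{p^2}$.
   Context: For a $p$-adic integer $x$, write $x=\sum_{j\ge0}(x)_jp^j$ with digits $(x)_j\in\{0,\dots,p-1\}$; so $(x)_0$ is the residue of $x$ mod $p$ and $(x)_1$ the next digit. Congruences are in $\mathbb{Z}_p$. $B_{p-1}$ is a Bernoulli number. For a permutation $(i_1,\dots,i_n)$ of $\{1,\dots,n\}$, an ascent is an index $k$ with $i_{k+1}>i_k$.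
   Formalization: Part (i) is stated only for odd primes p ≠ 3, since it fails at p = 3: there N_1 = 1 and A = 1/2, the left side is 1, the right side is −13/2, and the difference 15/2 is not divisible by 9 in Z_3. Part (ii) and A ∈ Z_p cover every odd prime. *)

theory Defs
  imports
    Complex_Main
    "HOL-Computational_Algebra.Primes"
    "HOL-Combinatorics.Permutations"
begin

text \<open>
  All \<open>p\<close>-adic numbers occurring here are rational, so \<open>\<int>\<^sub>p\<close> enters only through
  \<open>\<int>\<^sub>p \<inter> \<rat>\<close>, the ring of rationals with a denominator prime to \<open>p\<close>; moreover
  \<open>p\<^sup>n\<int>\<^sub>p \<inter> \<rat> = p\<^sup>n(\<int>\<^sub>p \<inter> \<rat>)\<close>, so congruences modulo powers of \<open>p\<close> between
  such rationals mean the same in both rings.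
\<close>

definition padic_ints :: "nat \<Rightarrow> rat set" where
  "padic_ints p = {of_int a / of_int b | a b :: int. \<not> int p dvd b}"

definition padic_cong :: "nat \<Rightarrow> rat \<Rightarrow> rat \<Rightarrow> nat \<Rightarrow> bool" where
  "padic_cong p x y m \<longleftrightarrow>
     x \<in> padic_ints p \<and> y \<in> padic_ints p \<and> (\<exists>z\<in>padic_ints p. x - y = of_nat m * z)"

text \<open>
  The expansion \<open>x = (\<Sum>j. d j * p ^ j)\<close> converges \<open>p\<close>-adically, i.e. each partial sum of
  length \<open>n\<close> agrees with \<open>x\<close> modulo \<open>p ^ n\<close>.
\<close>

definition padic_expansion :: "nat \<Rightarrow> rat \<Rightarrow> (nat \<Rightarrow> nat) \<Rightarrow> bool" where
  "padic_expansion p x d \<longleftrightarrow>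
     (\<forall>j. d j < p) \<and> (\<forall>n. padic_cong p x (of_nat (\<Sum>j<n. d j * p ^ j)) (p ^ n))"

definition padic_digit :: "nat \<Rightarrow> rat \<Rightarrow> nat \<Rightarrow> nat" where
  "padic_digit p x = (THE d. padic_expansion p x d)"

fun bernoulli :: "nat \<Rightarrow> rat" where
  "bernoulli 0 = 1"
| "bernoulli (Suc n) =
     - (\<Sum>k\<le>n. of_nat ((n + 2) choose k) * bernoulli k) / of_nat (n + 2)"

definition agoh_giuga_quotient :: "nat \<Rightarrow> rat" where
  "agoh_giuga_quotient p = (of_nat p * bernoulli (p - 1) + 1) / of_nat p"

definition ascents :: "nat \<Rightarrow> (nat \<Rightarrow> nat) \<Rightarrow> nat set" where
  "ascents n \<sigma> = {k \<in> {1..<n}. \<sigma> (Suc k) > \<sigma> k}"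

definition num_even_ascents :: "nat \<Rightarrow> nat" where
  "num_even_ascents n = card {\<sigma>. \<sigma> permutes {1..n} \<and> even (card (ascents n \<sigma>))}"

lemma of_int_in_padic_ints:
  assumes "prime p"
  shows "of_int a \<in> padic_ints p"
proof -
  have "(of_int a :: rat) = of_int a / of_int 1" by simp
  moreover have "\<not> int p dvd 1" using assms prime_nat_iff by auto
  ultimately show ?thesis unfolding padic_ints_def by blast
qed

lemma padic_cong_of_nat_iff:
  assumes p: "prime p"
  shows "padic_cong p (of_nat a) (of_nat b) (p ^ n) \<longleftrightarrow> a mod p ^ n = b mod p ^ n"
proof
  assume "padic_cong p (of_nat a) (of_nat b) (p ^ n)"
  then obtain u v :: int where v: "\<not> int p dvd v"
    and eq: "(of_nat a - of_nat b :: rat) = of_nat (p ^ n) * (of_int u / of_int v)"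
    unfolding padic_cong_def padic_ints_def by blast
  have v0: "v \<noteq> 0" using v by auto
  have "of_int ((int a - int b) * v) = (of_int (int p ^ n * u) :: rat)"
    using eq v0 by (simp add: field_simps)
  hence "(int a - int b) * v = int p ^ n * u" by (simp only: of_int_eq_iff)
  hence "int p ^ n dvd (int a - int b) * v" by simp
  moreover have "coprime (int p ^ n) v"
    using v p by (simp add: prime_imp_coprime coprime_power_left_iff)
  ultimately have "int p ^ n dvd int a - int b"
    by (simp add: coprime_dvd_mult_left_iff)
  hence "int a mod int (p ^ n) = int b mod int (p ^ n)"
    by (simp add: mod_eq_dvd_iff)
  thus "a mod p ^ n = b mod p ^ n" by (metis of_nat_eq_iff zmod_int)
next
  assume "a mod p ^ n = b mod p ^ n"
  hence "int a mod int (p ^ n) = int b mod int (p ^ n)" by (metis zmod_int)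
  then obtain c where "int a - int b = int (p ^ n) * c"
    by (auto simp: mod_eq_dvd_iff dvd_def)
  hence "of_int (int a - int b) = (of_int (int (p ^ n) * c) :: rat)" by simp
  hence "(of_nat a - of_nat b :: rat) = of_nat (p ^ n) * of_int c" by simp
  thus "padic_cong p (of_nat a) (of_nat b) (p ^ n)"
    unfolding padic_cong_def
    using of_int_in_padic_ints[OF p, of "int a"] of_int_in_padic_ints[OF p, of "int b"]
      of_int_in_padic_ints[OF p, of c] by auto
qed

lemma digit_sum_mod:
  fixes p :: nat
  shows "(\<Sum>j<n. (m div p ^ j mod p) * p ^ j) = m mod p ^ n"
proof (induction n)
  case (Suc n)
  have "m mod p ^ Suc n = p ^ n * (m div p ^ n mod p) + m mod p ^ n"
    unfolding power_Suc2 by (rule mod_mult2_eq)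
  with Suc show ?case by (simp only: sum.lessThan_Suc) (simp only: ac_simps)
qed simp

lemma digit_sum_less:
  fixes p :: nat
  assumes "\<And>j. d j < p"
  shows "(\<Sum>j<n. d j * p ^ j) < p ^ n"
proof (induction n)
  case (Suc n)
  have "(d n + 1) * p ^ n \<le> p * p ^ n"
    using assms[of n] by (intro mult_right_mono) auto
  with Suc show ?case by simp
qed simp

lemma padic_digit_of_nat:
  assumes p: "prime p"
  shows "padic_digit p (of_nat m) j = m div p ^ j mod p"
proof -
  have p0: "p > 0" using p by (rule prime_gt_0_nat)
  have "padic_digit p (of_nat m) = (\<lambda>j. m div p ^ j mod p)"
    unfolding padic_digit_def
  proof (rule the_equality)
    show "padic_expansion p (of_nat m) (\<lambda>j. m div p ^ j mod p)"
      unfolding padic_expansion_def padic_cong_of_nat_iff[OF p] digit_sum_mod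
      using p0 by simp
  next
    fix d assume "padic_expansion p (of_nat m) d"
    hence d: "\<And>j. d j < p"
      and "\<And>n. m mod p ^ n = (\<Sum>j<n. d j * p ^ j) mod p ^ n"
      unfolding padic_expansion_def padic_cong_of_nat_iff[OF p] by auto
    hence eq: "m mod p ^ n = (\<Sum>j<n. d j * p ^ j)" for n
      using digit_sum_less[of d p n] by simp
    show "d = (\<lambda>j. m div p ^ j mod p)"
    proof
      fix j
      have "m mod p ^ Suc j = (m div p ^ j mod p) * p ^ j + m mod p ^ j"
        using digit_sum_mod[of m p "Suc j"] digit_sum_mod[of m p j] by simp
      hence "d j * p ^ j = (m div p ^ j mod p) * p ^ j"
        using eq[of "Suc j"] eq[of j] unfolding sum.lessThan_Suc by linarith
      thus "d j = m div p ^ j mod p" using p0 by simp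
    qed
  qed
  thus ?thesis by simp
qed

end

theory Submission
  imports Defs
    "HOL-Computational_Algebra.Formal_Power_Series"
    "HOL-Combinatorics.Multiset_Permutations"
    "HOL-Number_Theory.Residues"
begin

text \<open>
  Put \<open>n = p - 2\<close> and let \<open>a\<^sub>n\<close> be the sum of \<open>(-1)\<close> to the number of ascents over all permutations
  of \<open>n\<close> letters, so that \<open>2 N\<^sub>n = n! + a\<^sub>n\<close>. Splitting a permutation at its maximum shows that the
  exponential generating function \<open>f\<close> of \<open>a\<close> satisfies \<open>f' = 2 f - f\<^sup>2\<close>, so
  \<open>f = 2 / (1 + exp (-2 x))\<close>. As \<open>f (1 + exp (2 x)) = 2 exp (2 x)\<close>, the alternating power sums up to
  \<open>p\<close> are expressed through the \<open>a\<^sub>j\<close>; since \<open>a\<^sub>j\<close> vanishes for even \<open>j > 0\<close>, only \<open>a\<^sub>n\<close> survives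
  modulo \<open>p\<^sup>2\<close>. Let \<open>O\<close> be the sum of the \<open>n\<close>-th powers of the odd numbers below \<open>p\<close>. The reflection
  \<open>x \<mapsto> p - x\<close> exchanges odd and even \<open>x\<close>, which gives \<open>2 ^ (p - 1) * O \<equiv> a\<^sub>n\<close>, and
  \<open>2 ^ (p - 1) \<equiv> 1 + p O\<close> by expanding \<open>(1 + 1) ^ p\<close>. Finally \<open>(p - 1)!\<close> and \<open>p B\<^bsub>p - 1\<^esub>\<close> are both
  determined modulo \<open>p\<^sup>2\<close> by the power sum \<open>\<Sum>x<p. x ^ (p - 1)\<close>, which relates \<open>n!\<close> to the Agoh-Giuga
  quotient; reflecting this power sum yields part (ii).
\<close>

unbundle fps_syntax

subsection \<open>The exponential generating function\<close>

text \<open>For coefficients scaled by \<open>fact n\<close>, as in exponential generating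
  functions, the Cauchy product becomes a binomial convolution.\<close>

lemma fact_times_fps_mult_nth:
  fixes F G :: "'a :: field_char_0 fps"
  shows "fact n * (F * G) $ n =
    (\<Sum>i\<le>n. of_nat (n choose i) * (fact i * F $ i) * (fact (n - i) * G $ (n - i)))"
  unfolding fps_mult_nth atLeast0AtMost sum_distrib_left
proof (rule sum.cong)
  fix i assume "i \<in> {..n}"
  hence "fact n = (of_nat (n choose i) * fact i * fact (n - i) :: 'a)"
    by (simp add: binomial_fact)
  thus "fact n * (F $ i * G $ (n - i)) =
      of_nat (n choose i) * (fact i * F $ i) * (fact (n - i) * G $ (n - i))"
    by simp
qed simp

text \<open>This series is 1 + tanh x; its scaled coefficients are, apart from the constant one,
  signed tangent numbers or zero.\<close>

definition alt_fps :: "rat fps" where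
  "alt_fps = fps_const 2 * inverse (1 + fps_exp (- 2))"

lemma alt_fps_mult: "alt_fps * (1 + fps_exp (- 2)) = 2"
proof -
  have "inverse (1 + fps_exp (- 2)) * (1 + fps_exp (- 2) :: rat fps) = 1"
    by (rule inverse_mult_eq_1) simp
  thus ?thesis
    unfolding alt_fps_def mult.assoc by (simp add: numeral_fps_const)
qed

lemma alt_fps_mult': "alt_fps * (1 + fps_exp 2) = 2 * fps_exp 2"
proof -
  have e: "fps_exp 2 * fps_exp (- 2) = (1 :: rat fps)"
    using fps_exp_add_mult[of 2 "- 2 :: rat"] by simp
  have "alt_fps * (1 + fps_exp 2) = alt_fps * (fps_exp 2 * fps_exp (- 2) + fps_exp 2)"
    by (simp only: e)
  also have "\<dots> = fps_exp 2 * (alt_fps * (1 + fps_exp (- 2)))"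
    by (simp only: algebra_simps mult_1_left)
  finally show ?thesis by (simp add: alt_fps_mult mult.commute)
qed

text \<open>Differentiating f D = 2 with D = 1 + exp (-2 x) gives f' D = 2 f (D - 1). Replacing the
  2 in the subtracted term 2 f by f D makes D a common factor, which cancels.\<close>

lemma fps_deriv_alt_fps: "fps_deriv alt_fps = 2 * alt_fps - alt_fps * alt_fps"
proof -
  define D where "D = (1 + fps_exp (- 2) :: rat fps)"
  have D: "alt_fps * D = 2" unfolding D_def by (rule alt_fps_mult)
  have D0: "D \<noteq> 0" using D by (auto simp: fps_numeral_nth)
  have D': "fps_deriv D = - 2 * (D - 1)"
    by (simp add: D_def numeral_fps_const fps_const_neg[symmetric] del: fps_const_neg)
  have "alt_fps * fps_deriv D + fps_deriv alt_fps * D = 0"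
    using arg_cong[OF D, of fps_deriv] by (simp add: numeral_fps_const)
  hence "fps_deriv alt_fps * D = - (alt_fps * fps_deriv D)"
    by (simp only: eq_neg_iff_add_eq_0 add.commute)
  also have "\<dots> = 2 * alt_fps * (D - 1)"
    unfolding D' by (simp add: algebra_simps)
  also have "\<dots> = 2 * alt_fps * D - (alt_fps * D) * alt_fps"
    unfolding D by (simp add: algebra_simps)
  also have "\<dots> = (2 * alt_fps - alt_fps * alt_fps) * D" by (simp add: algebra_simps)
  finally show ?thesis using D0 by simp
qed

definition alt_coeff :: "nat \<Rightarrow> rat" where
  "alt_coeff n = fact n * alt_fps $ n"

lemma alt_coeff_0 [simp]: "alt_coeff 0 = 1"
  using arg_cong[OF alt_fps_mult, of "\<lambda>f. f $ 0"]
  by (simp add: alt_coeff_def fps_mult_nth_0 fps_numeral_nth)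

text \<open>The Riccati equation read coefficientwise; signed permutations will be shown to obey the
  same recursion.\<close>

lemma alt_coeff_Suc:
  "alt_coeff (Suc n) =
     2 * alt_coeff n - (\<Sum>i\<le>n. of_nat (n choose i) * alt_coeff i * alt_coeff (n - i))"
proof -
  have "alt_coeff (Suc n) = fact n * fps_deriv alt_fps $ n"
    by (simp add: alt_coeff_def)
  also have "\<dots> = 2 * alt_coeff n - fact n * (alt_fps * alt_fps) $ n"
    unfolding fps_deriv_alt_fps by (simp add: alt_coeff_def numeral_fps_const algebra_simps)
  finally show ?thesis unfolding fact_times_fps_mult_nth alt_coeff_def .
qed

text \<open>Oddness of tanh in the form f(x) + f(-x) = 2, checked after multiplication by 1 + exp (2
  x), where both products are known.\<close>

lemma alt_coeff_even_eq_0: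
  assumes "even n" "n > 0"
  shows "alt_coeff n = 0"
proof -
  let ?h = "alt_fps oo (- fps_X)"
  have "?h * (1 + fps_exp 2) = 2"
    using arg_cong[OF alt_fps_mult, of "\<lambda>f. f oo (- fps_X)"]
    by (simp add: fps_compose_mult_distrib fps_compose_add_distrib)
  hence "(alt_fps + ?h) * (1 + fps_exp 2) = 2 * (1 + fps_exp 2)"
    unfolding distrib_right[of alt_fps ?h] alt_fps_mult' by (simp add: algebra_simps)
  moreover have "(1 + fps_exp 2 :: rat fps) $ 0 \<noteq> 0" by simp
  hence "1 + fps_exp 2 \<noteq> (0 :: rat fps)" by fastforce
  ultimately have "alt_fps + ?h = 2" by (metis mult_right_cancel)
  hence "(alt_fps + ?h) $ n = (2 :: rat fps) $ n" by simp
  moreover have "?h $ n = alt_fps $ n"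
    using assms fps_compose_linear[of alt_fps "-1"] by (simp add: fps_const_neg[symmetric] del: fps_const_neg)
  ultimately show ?thesis using assms by (simp add: alt_coeff_def fps_numeral_nth)
qed

text \<open>Multiplying f (1 + exp (2 x)) = 2 exp (2 x) by (-1)^k exp (2 k x) and summing over k < m
  telescopes the left side. Coefficients of x^n are then compared; the even exponents 2 (k + 1)
  account for the power of 2.\<close>

lemma alternating_power_sum:
  "2 ^ Suc n * (\<Sum>k<m. (- 1) ^ k * of_nat (Suc k) ^ n) =
     alt_coeff n - (- 1) ^ m * (\<Sum>j\<le>n. of_nat (n choose j) * alt_coeff j * (2 * of_nat m) ^ (n - j))"
proof -
  have "alt_fps - fps_const ((- 1) ^ m) * (alt_fps * fps_exp (2 * of_nat m)) =
      (\<Sum>k<m. fps_const (2 * (- 1) ^ k) * fps_exp (2 * of_nat (Suc k)))" for m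
  proof (induction m)
    case (Suc m)
    have e: "fps_exp (2 * of_nat (Suc m)) = fps_exp (2 * of_nat m) * (fps_exp 2 :: rat fps)"
      by (simp flip: fps_exp_add_mult add: algebra_simps)
    define s where "s = fps_const ((- 1) ^ m :: rat)"
    have c: "fps_const ((- 1) ^ Suc m) = - s" "fps_const (2 * (- 1) ^ m) = s * 2"
      "fps_const ((- 1) ^ m) = s"
      by (simp_all add: s_def numeral_fps_const mult.commute)
    have "alt_fps - fps_const ((- 1) ^ Suc m) * (alt_fps * fps_exp (2 * of_nat (Suc m))) =
        (alt_fps - fps_const ((- 1) ^ m) * (alt_fps * fps_exp (2 * of_nat m))) +
        s * fps_exp (2 * of_nat m) * (alt_fps * (1 + fps_exp 2))"
      unfolding e c by (simp add: algebra_simps)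
    also have "alt_fps - fps_const ((- 1) ^ m) * (alt_fps * fps_exp (2 * of_nat m)) =
        (\<Sum>k<m. fps_const (2 * (- 1) ^ k) * fps_exp (2 * of_nat (Suc k)))"
      by (rule Suc.IH)
    finally show ?case unfolding alt_fps_mult' sum.lessThan_Suc e c by (simp only: ac_simps)
  qed simp
  from arg_cong[OF this, of "\<lambda>f. f $ n" m]
  have "alt_fps $ n - (- 1) ^ m * (alt_fps * fps_exp (2 * of_nat m)) $ n =
      (\<Sum>k<m. 2 * (- 1) ^ k * ((2 * of_nat (Suc k)) ^ n / fact n))"
    by (simp add: fps_sum_nth del: of_nat_Suc)
  hence "fact n * (alt_fps $ n - (- 1) ^ m * (alt_fps * fps_exp (2 * of_nat m)) $ n) =
      2 ^ Suc n * (\<Sum>k<m. (- 1) ^ k * of_nat (Suc k) ^ n)"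
    by (simp add: sum_distrib_left power_mult_distrib mult_ac del: of_nat_Suc)
  moreover have "fact n * (alt_fps $ n - (- 1) ^ m * (alt_fps * fps_exp (2 * of_nat m)) $ n) =
      alt_coeff n - (- 1) ^ m * (fact n * (alt_fps * fps_exp (2 * of_nat m)) $ n)"
    by (simp add: alt_coeff_def algebra_simps)
  ultimately show ?thesis
    unfolding fact_times_fps_mult_nth by (simp add: alt_coeff_def)
qed

subsection \<open>Signed enumeration of permutations by ascents\<close>

text \<open>Lists over any linear order are used so that the blocks on either side of the maximum
  need no relabelling.\<close>

fun asc_sign :: "'a :: linorder list \<Rightarrow> rat" where
  "asc_sign (x # y # xs) = (if x < y then - 1 else 1) * asc_sign (y # xs)"
| "asc_sign _ = 1"

text \<open>Keeping the letter \<open>y\<close> in both pieces preserves every adjacent pair exactly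
  once.\<close>

lemma asc_sign_append: "asc_sign (xs @ y # ys) = asc_sign (xs @ [y]) * asc_sign (y # ys)"
proof (induction xs rule: asc_sign.induct)
  case ("2_2" x)
  then show ?case by (cases ys) auto
qed auto

text \<open>The step into the maximum is an ascent, if there is one, and the step out of it is a
  descent.\<close>

lemma asc_sign_split_max:
  assumes "\<And>x. x \<in> set xs \<union> set ys \<Longrightarrow> x < m"
  shows "asc_sign (xs @ m # ys) = (if xs = [] then 1 else - 1) * asc_sign xs * asc_sign ys"
proof -
  have 1: "asc_sign (m # ys) = asc_sign ys"
    using assms by (cases ys) (auto dest: order.asym)
  have 2: "asc_sign (xs @ [m]) = (if xs = [] then 1 else - 1) * asc_sign xs"
  proof (cases xs rule: rev_cases)
    case (snoc zs z)
    thus ?thesis using assms asc_sign_append[of zs z "[m]"] by auto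
  qed auto
  show ?thesis by (simp only: asc_sign_append[of xs m ys] 1 2)
qed

lemma sum_Pow_card:
  fixes g :: "nat \<Rightarrow> 'a :: comm_semiring_1"
  assumes "finite V"
  shows "(\<Sum>S\<in>Pow V. g (card S)) = (\<Sum>k\<le>card V. of_nat (card V choose k) * g k)"
proof -
  have "(\<Sum>S\<in>Pow V. g (card S)) = (\<Sum>k\<le>card V. \<Sum>S\<in>{S \<in> Pow V. card S = k}. g (card S))"
    using assms by (intro sum.group[symmetric]) (auto intro: card_mono)
  also have "\<dots> = (\<Sum>k\<le>card V. of_nat (card V choose k) * g k)"
    using n_subsets[OF assms] by (intro sum.cong) auto
  finally show ?thesis .
qed

text \<open>Cutting at the letter \<open>m\<close> is a bijection from arrangements to triples: the
  set of letters before \<open>m\<close>, its arrangement, and that of the remaining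
  letters.\<close>

lemma sum_permutations_of_set_split_at:
  assumes "m \<notin> V"
  shows "(\<Sum>xs\<in>permutations_of_set (insert m V). f xs) =
    (\<Sum>S\<in>Pow V. \<Sum>ys\<in>permutations_of_set S. \<Sum>zs\<in>permutations_of_set (V - S). f (ys @ m # zs))"
proof (cases "finite V")
  case True
  have "(\<Sum>S\<in>Pow V. \<Sum>ys\<in>permutations_of_set S. \<Sum>zs\<in>permutations_of_set (V - S). f (ys @ m # zs)) =
    (\<Sum>(S, ys, zs)\<in>(SIGMA S:Pow V. permutations_of_set S \<times> permutations_of_set (V - S)).
      f (ys @ m # zs))"
    using True by (simp add: sum.Sigma sum.cartesian_product case_prod_unfold finite_subset)
  also have "\<dots> = (\<Sum>xs\<in>permutations_of_set (insert m V). f xs)"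
  proof (rule sum.reindex_bij_witness[where
        j = "\<lambda>(S, ys, zs). ys @ m # zs" and
        i = "\<lambda>xs. (set (takeWhile (\<lambda>x. x \<noteq> m) xs), takeWhile (\<lambda>x. x \<noteq> m) xs,
                   tl (dropWhile (\<lambda>x. x \<noteq> m) xs))"])
    fix t assume t: "t \<in> (SIGMA S:Pow V. permutations_of_set S \<times> permutations_of_set (V - S))"
    obtain S ys zs where t_eq: "t = (S, ys, zs)" by (cases t)
    have S: "S \<subseteq> V" "set ys = S" "distinct ys" "set zs = V - S" "distinct zs"
      using t permutations_of_setD[of ys S] permutations_of_setD[of zs "V - S"]
      unfolding t_eq by simp_all
    moreover have "m \<notin> set ys" using S assms by auto
    ultimately show "(\<lambda>xs. (set (takeWhile (\<lambda>x. x \<noteq> m) xs), takeWhile (\<lambda>x. x \<noteq> m) xs,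
                   tl (dropWhile (\<lambda>x. x \<noteq> m) xs))) ((\<lambda>(S, ys, zs). ys @ m # zs) t) = t"
      unfolding t_eq by (auto simp: takeWhile_append dropWhile_append)
    show "(\<lambda>(S, ys, zs). ys @ m # zs) t \<in> permutations_of_set (insert m V)"
      unfolding t_eq using S assms by (auto intro!: permutations_of_setI)
  next
    fix xs assume "xs \<in> permutations_of_set (insert m V)"
    hence xs: "set xs = insert m V" "distinct xs" by (auto dest: permutations_of_setD)
    then obtain ys zs where eq: "xs = ys @ m # zs" using split_list[of m xs] by auto
    hence "m \<notin> set ys" "m \<notin> set zs" using xs by auto
    with eq have tw: "takeWhile (\<lambda>x. x \<noteq> m) xs = ys" "dropWhile (\<lambda>x. x \<noteq> m) xs = m # zs"
      by (auto simp: takeWhile_append dropWhile_append)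
    show "(\<lambda>(S, ys, zs). ys @ m # zs) (set (takeWhile (\<lambda>x. x \<noteq> m) xs),
        takeWhile (\<lambda>x. x \<noteq> m) xs, tl (dropWhile (\<lambda>x. x \<noteq> m) xs)) = xs"
      by (simp add: tw eq[symmetric])
    have "set ys \<subseteq> V" "set zs = V - set ys" "distinct ys" "distinct zs"
      using xs assms unfolding eq by auto
    thus "(set (takeWhile (\<lambda>x. x \<noteq> m) xs), takeWhile (\<lambda>x. x \<noteq> m) xs,
        tl (dropWhile (\<lambda>x. x \<noteq> m) xs)) \<in>
        (SIGMA S:Pow V. permutations_of_set S \<times> permutations_of_set (V - S))"
      by (auto simp: tw intro!: permutations_of_setI)
  qed auto
  finally show ?thesis ..
next
  case False
  thus ?thesis
    \<comment> \<open>One of \<open>S\<close> and \<open>V - S\<close> is infinite and has no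
      arrangements, so both sides are 0.\<close>
    by (auto intro!: sum.neutral simp: permutations_of_set_infinite finite_Diff2)
qed

text \<open>Splitting at the maximum makes the signed count factor over the two blocks; summing over
  the possible left blocks gives the recursion \<open>alt_coeff_Suc\<close>.\<close>

lemma sum_asc_sign:
  fixes V :: "'a :: linorder set"
  assumes "finite V"
  shows "(\<Sum>xs\<in>permutations_of_set V. asc_sign xs) = alt_coeff (card V)"
  using assms
proof (induction "card V" arbitrary: V rule: less_induct)
  case less
  show ?case
  proof (cases "V = {}")
    case False
    define m W where "m = Max V" and "W = V - {m}"
    have fin: "finite W" and m: "m \<notin> W" and V: "V = insert m W"
      using less.prems Max_in[OF less.prems False] by (auto simp: m_def W_def)
    have lt: "x < m" if "x \<in> W" for x
      using that less.prems Max_ge[of V x] by (auto simp: m_def W_def order_less_le)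
    have card: "card V = Suc (card W)" using fin m V by simp
    have IH: "(\<Sum>xs\<in>permutations_of_set S. asc_sign xs) = alt_coeff (card S)" if "S \<subseteq> W" for S
      using that fin card by (intro less.hyps) (auto dest: card_mono finite_subset simp: less_Suc_eq_le)
    define e where "e k = (if k = 0 then 1 else - 1 :: rat)" for k :: nat
    have "(\<Sum>xs\<in>permutations_of_set V. asc_sign xs) =
      (\<Sum>S\<in>Pow W. \<Sum>ys\<in>permutations_of_set S. \<Sum>zs\<in>permutations_of_set (W - S).
        asc_sign (ys @ m # zs))"
      unfolding V by (rule sum_permutations_of_set_split_at[OF m])
    also have "\<dots> = (\<Sum>S\<in>Pow W. \<Sum>ys\<in>permutations_of_set S. \<Sum>zs\<in>permutations_of_set (W - S).
        e (card S) * (asc_sign ys * asc_sign zs))"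
    proof (intro sum.cong refl)
      fix S ys zs
      assume S: "S \<in> Pow W" and ys: "ys \<in> permutations_of_set S"
        and zs: "zs \<in> permutations_of_set (W - S)"
      hence "x < m" if "x \<in> set ys \<union> set zs" for x
        using that lt permutations_of_setD by fast
      moreover have "ys = [] \<longleftrightarrow> card S = 0"
        using S ys fin by (auto dest: permutations_of_setD finite_subset)
      ultimately show "asc_sign (ys @ m # zs) = e (card S) * (asc_sign ys * asc_sign zs)"
        using asc_sign_split_max[of ys zs m] by (simp add: e_def)
    qed
    also have "\<dots> = (\<Sum>S\<in>Pow W. e (card S) * (alt_coeff (card S) * alt_coeff (card (W - S))))"
      by (intro sum.cong refl)
        (simp add: IH Diff_subset flip: sum_distrib_left sum_distrib_right)
    also have "\<dots> = (\<Sum>S\<in>Pow W. e (card S) * (alt_coeff (card S) * alt_coeff (card W - card S)))"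
      using fin by (intro sum.cong refl) (auto simp: card_Diff_subset finite_subset)
    also have "\<dots> = (\<Sum>k\<le>card W. of_nat (card W choose k) *
        (e k * (alt_coeff k * alt_coeff (card W - k))))"
      by (rule sum_Pow_card[OF fin])
    \<comment> \<open>Only the empty left block has sign +1. Writing its term a as 2 a - a gives all
      convolution terms the sign -1.\<close>
    also have "\<dots> = (\<Sum>k\<le>card W. (if k = 0 then 2 * alt_coeff (card W) else 0) -
        of_nat (card W choose k) * alt_coeff k * alt_coeff (card W - k))"
      by (intro sum.cong refl) (auto simp: e_def)
    also have "\<dots> = alt_coeff (card V)"
      by (simp add: sum_subtractf alt_coeff_Suc card)
    finally show ?thesis .
  qed simp
qed

lemma asc_sign_map_upt: "asc_sign (map \<sigma> [1..<Suc n]) = (- 1) ^ card (ascents n \<sigma>)"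
proof (induction n)
  case (Suc n)
  show ?case
  proof (cases n)
    case (Suc k)
    have "ascents (Suc n) \<sigma> = (if \<sigma> n < \<sigma> (Suc n) then insert n else id) (ascents n \<sigma>)"
      using Suc by (auto simp: ascents_def less_Suc_eq)
    moreover have "n \<notin> ascents n \<sigma>" "finite (ascents n \<sigma>)" by (auto simp: ascents_def)
    moreover have "asc_sign (map \<sigma> [1..<Suc (Suc n)]) =
        asc_sign (map \<sigma> [1..<Suc n]) * asc_sign [\<sigma> n, \<sigma> (Suc n)]"
      using Suc asc_sign_append[of "map \<sigma> [1..<n]" "\<sigma> n" "[\<sigma> (Suc n)]"] by simp
    ultimately show ?thesis using Suc.IH by simp
  qed (auto simp: ascents_def)
qed (auto simp: ascents_def)

text \<open>Surjectivity follows from injectivity, since both sets have n! elements.\<close>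

lemma bij_betw_permutes_permutations_of_set:
  "bij_betw (\<lambda>\<sigma>. map \<sigma> [1..<Suc n]) {\<sigma>. \<sigma> permutes {1..n}} (permutations_of_set {1..n})"
proof -
  let ?F = "\<lambda>\<sigma>. map \<sigma> [1..<Suc n]" and ?P = "{\<sigma>. \<sigma> permutes {1..n}}"
  have inj: "inj_on ?F ?P"
  proof (intro inj_onI ext)
    fix \<sigma> \<tau> x assume *: "\<sigma> \<in> ?P" "\<tau> \<in> ?P" "?F \<sigma> = ?F \<tau>"
    show "\<sigma> x = \<tau> x"
    proof (cases "x \<in> {1..n}")
      case True
      moreover have "\<forall>y\<in>set [1..<Suc n]. \<sigma> y = \<tau> y" using * by (simp only: map_eq_conv)
      ultimately show ?thesis by auto
    qed (use * in \<open>auto simp: permutes_def\<close>)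
  qed
  moreover have "?F ` ?P = permutations_of_set {1..n}"
  proof (rule card_subset_eq)
    have upt: "set [1..<Suc n] = {1..n}" by auto
    show "?F ` ?P \<subseteq> permutations_of_set {1..n}"
    proof (intro image_subsetI permutations_of_setI)
      fix \<sigma> assume "\<sigma> \<in> ?P"
      hence \<sigma>: "\<sigma> permutes {1..n}" by simp
      show "set (?F \<sigma>) = {1..n}"
        unfolding set_map upt by (rule permutes_image[OF \<sigma>])
      show "distinct (?F \<sigma>)"
        unfolding distinct_map upt using permutes_inj_on[OF \<sigma>] by simp
    qed
    show "card (?F ` ?P) = card (permutations_of_set {1..n})"
      unfolding card_image[OF inj] by (simp add: card_permutations)
  qed simp
  ultimately show ?thesis by (simp add: bij_betw_def)
qed

text \<open>Adding 1 to the sign counts each permutation with an even number of ascents twice and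
  the others not at all.\<close>

lemma two_num_even_ascents: "of_nat (2 * num_even_ascents n) = fact n + alt_coeff n"
proof -
  let ?P = "{\<sigma>. \<sigma> permutes {1..n}}"
  have fin: "finite ?P" by (simp add: finite_permutations)
  have "(\<Sum>\<sigma>\<in>?P. asc_sign (map \<sigma> [1..<Suc n])) = alt_coeff n"
    unfolding sum.reindex_bij_betw[OF bij_betw_permutes_permutations_of_set]
    by (simp add: sum_asc_sign)
  hence "fact n + alt_coeff n = (\<Sum>\<sigma>\<in>?P. 1 + (- 1) ^ card (ascents n \<sigma>))"
    unfolding asc_sign_map_upt sum.distrib by (simp add: card_permutations)
  also have "\<dots> = (\<Sum>\<sigma>\<in>?P. if even (card (ascents n \<sigma>)) then 2 else 0)"
    by (intro sum.cong) auto
  also have "\<dots> = of_nat (2 * num_even_ascents n)"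
    using fin by (simp add: num_even_ascents_def sum.If_cases Int_def)
  finally show ?thesis ..
qed

subsection \<open>Power sums and Bernoulli numbers\<close>

text \<open>The defining recursion states that the sum of \<open>n choose i\<close> times B_i over i
  < n vanishes for n >= 2. The term i = n is absent because exp x - 1 has no constant term.\<close>

lemma bernoulli_fps: "Abs_fps (\<lambda>n. bernoulli n / fact n) * (fps_exp 1 - 1) = fps_X"
proof (rule fps_ext)
  fix n
  let ?B = "Abs_fps (\<lambda>n. bernoulli n / fact n)"
  have "fact n * (?B * (fps_exp 1 - 1)) $ n =
      (\<Sum>i\<le>n. if i = n then 0 else of_nat (n choose i) * bernoulli i)"
    unfolding fact_times_fps_mult_nth by (intro sum.cong refl) auto
  also have "\<dots> = (\<Sum>i<n. of_nat (n choose i) * bernoulli i)"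
    by (simp add: lessThan_Suc_atMost[symmetric])
  also have "\<dots> = fact n * fps_X $ n"
  proof -
    consider "n = 0" | "n = 1" | m where "n = Suc (Suc m)"
      by (metis One_nat_def not0_implies_Suc)
    thus ?thesis
    proof cases
      \<comment> \<open>The top term i = m + 1 has coefficient m + 2, exactly the denominator in the
        recursion for \<open>bernoulli (Suc m)\<close>.\<close>
      case 3
      have "(\<Sum>i<n. of_nat (n choose i) * bernoulli i) =
          of_nat (m + 2) * bernoulli (Suc m) + (\<Sum>k\<le>m. of_nat ((m + 2) choose k) * bernoulli k)"
        using binomial_symmetric[of 1 n]
        by (simp add: 3 lessThan_Suc_atMost[symmetric] del: bernoulli.simps binomial_Suc_Suc)
      also have "\<dots> = 0" by (simp del: binomial_Suc_Suc)
      finally show ?thesis using 3 by simp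
    qed simp_all
  qed
  finally show "(?B * (fps_exp 1 - 1)) $ n = fps_X $ n" by simp
qed

text \<open>Faulhaber's formula: the geometric sum of exp (k x) times exp x - 1 is exp (m x) - 1,
  and multiplying by the Bernoulli series leaves a factor x.\<close>

lemma power_sum_bernoulli:
  "of_nat (Suc n) * (\<Sum>k<m. of_nat k ^ n) =
     (\<Sum>i\<le>n. of_nat (Suc n choose i) * bernoulli i * of_nat m ^ (Suc n - i))"
proof -
  let ?B = "Abs_fps (\<lambda>n. bernoulli n / fact n)"
  have "(fps_exp 1 - 1) * (\<Sum>k<m. fps_exp (of_nat k)) = (fps_exp (of_nat m) - 1 :: rat fps)"
  proof (induction m)
    case (Suc m)
    have "fps_exp (of_nat (Suc m)) = fps_exp 1 * (fps_exp (of_nat m) :: rat fps)"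
      by (simp flip: fps_exp_add_mult)
    with Suc show ?case by (simp add: algebra_simps)
  qed simp
  hence "?B * (fps_exp (of_nat m) - 1) = ?B * (fps_exp 1 - 1) * (\<Sum>k<m. fps_exp (of_nat k))"
    by (simp only: mult.assoc)
  also have "\<dots> = fps_X * (\<Sum>k<m. fps_exp (of_nat k))" by (simp only: bernoulli_fps)
  finally have "fact (Suc n) * (?B * (fps_exp (of_nat m) - 1)) $ Suc n =
      of_nat (Suc n) * (\<Sum>k<m. of_nat k ^ n)"
    by (simp add: fps_sum_nth sum_distrib_left)
  hence "of_nat (Suc n) * (\<Sum>k<m. of_nat k ^ n) = fact (Suc n) * (?B * (fps_exp (of_nat m) - 1)) $ Suc n" ..
  also have "\<dots> = (\<Sum>i\<le>n. of_nat (Suc n choose i) * bernoulli i * of_nat m ^ (Suc n - i))"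
    unfolding fact_times_fps_mult_nth sum.atMost_Suc[of _ n]
    by (subst add.commute, subst add_0_left[symmetric], rule arg_cong2[of _ _ _ _ "(+)"])
      (auto simp del: binomial_Suc_Suc of_nat_Suc bernoulli.simps intro!: sum.cong)
  finally show ?thesis .
qed

section \<open>Rationals integral at an odd prime, and Bernoulli numbers among them\<close>

locale odd_prime =
  fixes p :: nat
  assumes prime: "prime p" and odd: "odd p"
begin

lemma ge_3: "p \<ge> 3"
  using prime_ge_2_nat[OF prime] odd by (cases "p = 2") auto

lemma prime_int: "prime (int p)"
  using prime by simp

lemma int_in_padic_ints [simp]: "of_int a \<in> padic_ints p"
  by (rule of_int_in_padic_ints[OF prime])

lemma nat_in_padic_ints [simp]: "of_nat a \<in> padic_ints p"
  using int_in_padic_ints[of "int a"] by simp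

lemma const_in_padic_ints [simp]: "0 \<in> padic_ints p" "1 \<in> padic_ints p" "numeral k \<in> padic_ints p"
  using int_in_padic_ints[of 0] int_in_padic_ints[of 1] int_in_padic_ints[of "numeral k"] by simp_all

lemma padic_ints_mult [intro]:
  assumes "x \<in> padic_ints p" "y \<in> padic_ints p"
  shows "x * y \<in> padic_ints p"
proof -
  obtain a b c d where *: "x = of_int a / of_int b" "y = of_int c / of_int d"
    "\<not> int p dvd b" "\<not> int p dvd d"
    using assms unfolding padic_ints_def by blast
  have "x * y = of_int (a * c) / of_int (b * d)" "\<not> int p dvd b * d"
    using * prime_int by (simp_all add: prime_dvd_mult_iff)
  thus ?thesis unfolding padic_ints_def by blast
qed

lemma padic_ints_add [intro]:
  assumes "x \<in> padic_ints p" "y \<in> padic_ints p"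
  shows "x + y \<in> padic_ints p"
proof -
  obtain a b c d where *: "x = of_int a / of_int b" "y = of_int c / of_int d"
    "\<not> int p dvd b" "\<not> int p dvd d"
    using assms unfolding padic_ints_def by blast
  moreover from * have "b \<noteq> 0" "d \<noteq> 0" by auto
  ultimately have "x + y = of_int (a * d + c * b) / of_int (b * d)" "\<not> int p dvd b * d"
    using prime_int by (simp_all add: prime_dvd_mult_iff field_simps)
  thus ?thesis unfolding padic_ints_def by blast
qed

lemma padic_ints_minus [intro]: "x \<in> padic_ints p \<Longrightarrow> - x \<in> padic_ints p"
  using padic_ints_mult[of "of_int (- 1)" x, OF int_in_padic_ints] by simp

lemma padic_ints_diff [intro]: "x \<in> padic_ints p \<Longrightarrow> y \<in> padic_ints p \<Longrightarrow> x - y \<in> padic_ints p"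
  using padic_ints_add[of x "- y"] padic_ints_minus[of y] by simp

lemma padic_ints_power [intro]: "x \<in> padic_ints p \<Longrightarrow> x ^ n \<in> padic_ints p"
  by (induction n) auto

lemma padic_ints_sum [intro]: "(\<And>i. i \<in> I \<Longrightarrow> f i \<in> padic_ints p) \<Longrightarrow> sum f I \<in> padic_ints p"
  by (induction I rule: infinite_finite_induct) auto

lemma padic_ints_divide [intro]:
  assumes "x \<in> padic_ints p" "\<not> p dvd k"
  shows "x / of_nat k \<in> padic_ints p"
proof -
  have "1 / of_nat k = (of_int 1 / of_int (int k) :: rat)" by simp
  moreover have "\<not> int p dvd int k" using assms by simp
  ultimately have "1 / of_nat k \<in> padic_ints p" unfolding padic_ints_def by blast
  with assms(1) have "x * (1 / of_nat k) \<in> padic_ints p" by (rule padic_ints_mult)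
  thus ?thesis by simp
qed

text \<open>Returns from rationals to integers: a denominator prime to p cannot cancel the factor
  p.\<close>

lemma dvd_if_padic:
  assumes "of_int a = of_nat p * z" "z \<in> padic_ints p"
  shows "int p dvd a"
proof -
  obtain u v where uv: "z = of_int u / of_int v" "\<not> int p dvd v"
    using assms(2) unfolding padic_ints_def by blast
  moreover from uv have "v \<noteq> 0" by auto
  ultimately have "(of_int (a * v) :: rat) = of_int (int p * u)"
    using assms(1) by (simp add: field_simps)
  hence "a * v = int p * u" by (simp only: of_int_eq_iff)
  hence "int p dvd a * v" by simp
  thus ?thesis using uv(2) prime_int by (simp add: prime_dvd_mult_iff)
qed

text \<open>The recursion for B_n divides only by n + 1, which is below p. The bound stops just
  short of B_(p-1), whose denominator does contain p.\<close>

lemma bernoulli_in_padic_ints: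
  assumes "n + 1 < p"
  shows "bernoulli n \<in> padic_ints p"
  using assms
proof (induction n rule: less_induct)
  case (less n)
  show ?case
  proof (cases n)
    case (Suc m)
    have "\<not> p dvd m + 2" using less.prems Suc by (auto dest: dvd_imp_le)
    moreover have "- (\<Sum>k\<le>m. of_nat ((m + 2) choose k) * bernoulli k) \<in> padic_ints p"
      using less Suc by (intro padic_ints_minus padic_ints_sum padic_ints_mult) auto
    ultimately show ?thesis
      unfolding Suc bernoulli.simps by (rule padic_ints_divide[rotated])
  qed simp
qed

text \<open>In Faulhaber's formula at p, divided by n + 1, the term i = n is p B_n and every other
  term is p^2 times a p-integral number. The case n = p - 1 is included, so B_n itself need not be
  p-integral.\<close>

lemma power_sum_padic:
  assumes "n < p"
  obtains z where "z \<in> padic_ints p"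
    "(\<Sum>k<p. of_nat k ^ n) = of_nat p * bernoulli n + of_nat (p\<^sup>2) * z"
proof
  define t where "t i = of_nat (n choose i) * bernoulli i *
    (of_nat p ^ (n - 1 - i) / of_nat (n + 1 - i))" for i
  show "(\<Sum>i<n. t i) \<in> padic_ints p"
  proof (rule padic_ints_sum)
    fix i assume i: "i \<in> {..<n}"
    have "of_nat p ^ (n - 1 - i) / of_nat (n + 1 - i) \<in> padic_ints p"
    \<comment> \<open>The denominator is at most p, with equality only for i = 0 and n = p - 1; then
      the numerator is p^(p-2), which still contains p.\<close>
    proof (cases "n + 1 - i = p")
      case True
      hence eq: "n - 1 - i = Suc (p - 3)" using ge_3 i by auto
      show ?thesis unfolding True eq using ge_3 by (auto simp: padic_ints_power)
    next
      case False
      hence "\<not> p dvd n + 1 - i" using assms i by (auto dest!: dvd_imp_le)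
      thus ?thesis by (intro padic_ints_divide padic_ints_power) auto
    qed
    moreover have "bernoulli i \<in> padic_ints p" using assms i by (intro bernoulli_in_padic_ints) auto
    ultimately show "t i \<in> padic_ints p" unfolding t_def by (intro padic_ints_mult) auto
  qed
  have t: "of_nat (Suc n choose i) * bernoulli i * of_nat p ^ (Suc n - i) =
      of_nat (Suc n) * (of_nat (p\<^sup>2) * t i)" if "i < n" for i
  proof -
    have "(Suc n choose i) * (Suc n - i) = Suc n * (n choose i)"
      using binomial_absorb_comp[of "Suc n" i] by (simp add: mult.commute)
    hence "of_nat (Suc n choose i) * of_nat (Suc n - i) = (of_nat (Suc n) * of_nat (n choose i) :: rat)"
      by (simp only: flip: of_nat_mult)
    moreover have "of_nat (Suc n - i) \<noteq> (0 :: rat)" using that by simp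
    ultimately have "of_nat (Suc n choose i) = (of_nat (Suc n) * of_nat (n choose i) / of_nat (Suc n - i) :: rat)"
      by (simp only: eq_divide_eq if_True not_False_eq_True)
    moreover have "Suc n - i = 2 + (n - 1 - i)" using that by simp
    hence "of_nat p ^ (Suc n - i) = (of_nat (p\<^sup>2) * of_nat p ^ (n - 1 - i) :: rat)"
      by (simp only: power_add of_nat_power)
    ultimately show ?thesis unfolding t_def by simp
  qed
  have "(\<Sum>i<n. of_nat (Suc n choose i) * bernoulli i * of_nat p ^ (Suc n - i)) =
      of_nat (Suc n) * (of_nat (p\<^sup>2) * (\<Sum>i<n. t i))"
    unfolding sum_distrib_left by (intro sum.cong refl t) simp
  hence "of_nat (Suc n) * (\<Sum>k<p. of_nat k ^ n) =
      of_nat (Suc n) * (of_nat p * bernoulli n + of_nat (p\<^sup>2) * (\<Sum>i<n. t i))"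
    unfolding power_sum_bernoulli lessThan_Suc_atMost[symmetric] sum.lessThan_Suc
    by (simp add: distrib_left mult_ac del: binomial_Suc_Suc of_nat_Suc)
  thus "(\<Sum>k<p. of_nat k ^ n) = of_nat p * bernoulli n + of_nat (p\<^sup>2) * (\<Sum>i<n. t i)"
    unfolding mult_cancel_left by simp
qed

end

subsection \<open>Congruences for power sums\<close>

text \<open>An integer copy of \<open>alt_coeff\<close>, for use in integer congruences.\<close>

definition alt_int :: "nat \<Rightarrow> int" where
  "alt_int n = 2 * int (num_even_ascents n) - fact n"

lemma of_int_alt_int: "of_int (alt_int n) = alt_coeff n"
  using two_num_even_ascents[of n] by (simp add: alt_int_def)

lemma alternating_power_sum_int:
  "2 ^ Suc n * (\<Sum>k<m. (- 1) ^ k * int (Suc k) ^ n) =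
     alt_int n - (- 1) ^ m * (\<Sum>j\<le>n. int (n choose j) * alt_int j * (2 * int m) ^ (n - j))"
proof -
  have "(of_int (2 ^ Suc n * (\<Sum>k<m. (- 1) ^ k * int (Suc k) ^ n)) :: rat) =
      of_int (alt_int n - (- 1) ^ m *
        (\<Sum>j\<le>n. int (n choose j) * alt_int j * (2 * int m) ^ (n - j)))"
    using alternating_power_sum[of n m] by (simp add: of_int_alt_int del: of_nat_Suc)
  thus ?thesis by (simp only: of_int_eq_iff)
qed

text \<open>Terms with j < n contain m; the term j = n doubles \<open>alt_int n\<close> because m is
  odd.\<close>

lemma alternating_power_sum_cong:
  assumes "odd m"
  shows "[2 ^ Suc n * (\<Sum>k<m. (- 1) ^ k * int (Suc k) ^ n) = 2 * alt_int n] (mod int m)"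
proof -
  have "int m dvd (\<Sum>j<n. int (n choose j) * alt_int j * (2 * int m) ^ (n - j))"
    by (intro dvd_sum dvd_mult) (auto intro!: dvd_power_le)
  thus ?thesis
    using assms unfolding alternating_power_sum_int lessThan_Suc_atMost[symmetric] sum.lessThan_Suc
    by (simp add: cong_iff_dvd_diff)
qed

text \<open>The only further term not visibly divisible by m^2 is j = n - 1, and its coefficient
  vanishes because n - 1 is even and positive. For n = 1 that coefficient would be 1.\<close>

lemma alternating_power_sum_cong_square:
  assumes "odd m" "odd n" "n \<ge> 3"
  shows "[2 ^ Suc n * (\<Sum>k<m. (- 1) ^ k * int (Suc k) ^ n) = 2 * alt_int n] (mod int m ^ 2)"
proof -
  obtain l where n: "n = Suc l" using assms by (cases n) auto
  have l: "even l" "l > 0" using assms n by auto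
  have "of_int (alt_int l) = (0 :: rat)"
    unfolding of_int_alt_int by (rule alt_coeff_even_eq_0[OF l])
  hence 0: "alt_int l = 0" by simp
  have "int m ^ 2 dvd (\<Sum>j<l. int (n choose j) * alt_int j * (2 * int m) ^ (n - j))"
    unfolding n by (intro dvd_sum dvd_mult)
      (auto simp: power_mult_distrib intro!: dvd_mult le_imp_power_dvd)
  thus ?thesis
    using assms 0 unfolding alternating_power_sum_int lessThan_Suc_atMost[symmetric] sum.lessThan_Suc
    by (simp add: cong_iff_dvd_diff n)
qed

text \<open>The exponent is \<open>Suc n\<close> so that the linear term needs no truncated
  subtraction.\<close>

lemma power_add_cong_square:
  fixes a b m :: int
  shows "[(a + b * m) ^ Suc n = a ^ Suc n + of_nat (Suc n) * a ^ n * b * m] (mod m\<^sup>2)"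
proof (induction n)
  case (Suc n)
  have "[(a + b * m) * (a + b * m) ^ Suc n =
      (a + b * m) * (a ^ Suc n + of_nat (Suc n) * a ^ n * b * m)] (mod m\<^sup>2)"
    by (intro cong_mult cong_refl Suc.IH)
  also have "[(a + b * m) * (a ^ Suc n + of_nat (Suc n) * a ^ n * b * m) =
      a ^ Suc (Suc n) + of_nat (Suc (Suc n)) * a ^ Suc n * b * m] (mod m\<^sup>2)"
    unfolding cong_iff_dvd_diff dvd_def
    by (rule exI[of _ "of_nat (Suc n) * a ^ n * b\<^sup>2"]) (simp add: algebra_simps power2_eq_square)
  finally show ?case by simp
qed simp

lemma prod_one_plus_cong_square:
  fixes m :: int
  shows "[(\<Prod>x\<in>X. 1 + m * f x) = 1 + m * (\<Sum>x\<in>X. f x)] (mod m\<^sup>2)"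
proof (induction X rule: infinite_finite_induct)
  case (insert x X)
  have "[(1 + m * f x) * (\<Prod>x\<in>X. 1 + m * f x) = (1 + m * f x) * (1 + m * (\<Sum>x\<in>X. f x))] (mod m\<^sup>2)"
    by (intro cong_mult cong_refl insert.IH)
  also have "[(1 + m * f x) * (1 + m * (\<Sum>x\<in>X. f x)) = 1 + m * (f x + (\<Sum>x\<in>X. f x))] (mod m\<^sup>2)"
    unfolding cong_iff_dvd_diff dvd_def
    by (rule exI[of _ "f x * (\<Sum>x\<in>X. f x)"]) (simp add: algebra_simps power2_eq_square)
  finally show ?case using insert.hyps by simp
qed simp_all

section \<open>Power sums over the odd and the even numbers below p\<close>

definition odd_sum :: "nat \<Rightarrow> nat \<Rightarrow> int" where
  "odd_sum p n = (\<Sum>x | x \<in> {1..p - 1} \<and> odd x. int x ^ n)"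

definition even_sum :: "nat \<Rightarrow> nat \<Rightarrow> int" where
  "even_sum p n = (\<Sum>x | x \<in> {1..p - 1} \<and> even x. int x ^ n)"

lemma sum_split_parity:
  fixes f :: "nat \<Rightarrow> 'a :: comm_monoid_add"
  shows "(\<Sum>x\<in>{1..p - 1}. f x) =
    (\<Sum>x | x \<in> {1..p - 1} \<and> odd x. f x) + (\<Sum>x | x \<in> {1..p - 1} \<and> even x. f x)"
  by (subst sum.union_disjoint[symmetric]) (auto intro!: sum.cong)

context odd_prime
begin

lemma odd_sum_add_even_sum:
  "n > 0 \<Longrightarrow> odd_sum p n + even_sum p n = (\<Sum>x<p. int x ^ n)"
proof -
  assume n: "n > 0"
  have "{..<p} = insert 0 {1..p - 1}" using ge_3 by auto
  thus ?thesis
    unfolding odd_sum_def even_sum_def sum_split_parity[symmetric] using n by simp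
qed

text \<open>The last index k = p - 1 is even and contributes p^n, which lies outside both partial
  sums.\<close>

lemma alternating_sum_eq:
  "(\<Sum>k<p. (- 1) ^ k * int (Suc k) ^ n) = odd_sum p n - even_sum p n + int p ^ n"
proof -
  obtain q where q: "p = Suc q" "even q" using odd by (cases p) auto
  have "(\<Sum>k<p. (- 1) ^ k * int (Suc k) ^ n) =
      (\<Sum>k<q. (- 1) ^ k * int (Suc k) ^ n) + int p ^ n"
    using q by simp
  also have "(\<Sum>k<q. (- 1) ^ k * int (Suc k) ^ n) = (\<Sum>x\<in>{1..q}. (- 1) ^ Suc x * int x ^ n)"
    by (rule sum.reindex_bij_witness[of _ "\<lambda>x. x - 1" Suc]) auto
  also have "\<dots> = odd_sum p n - even_sum p n"
    using sum_split_parity[of "\<lambda>x. (- 1) ^ Suc x * int x ^ n" p] q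
    by (simp add: odd_sum_def even_sum_def sum_negf)
  finally show ?thesis .
qed

text \<open>As p is odd, x to p - x exchanges the parities; (p - x)^(n+1) is expanded to first order
  in p.\<close>

lemma even_sum_cong:
  "[even_sum p (Suc n) =
     (- 1) ^ Suc n * (odd_sum p (Suc n) - of_nat (Suc n) * int p * odd_sum p n)] (mod (int p)\<^sup>2)"
proof -
  have 1: "even_sum p (Suc n) = (\<Sum>x | x \<in> {1..p - 1} \<and> odd x. int (p - x) ^ Suc n)"
    unfolding even_sum_def
    by (rule sum.reindex_bij_witness[of _ "\<lambda>x. p - x" "\<lambda>x. p - x"]) (use odd in auto)
  have 2: "(- 1) ^ Suc n * (int x ^ Suc n - of_nat (Suc n) * int p * int x ^ n) =
      (- int x) ^ Suc n + of_nat (Suc n) * (- int x) ^ n * 1 * int p" for x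
  proof -
    define u v where "u = (- 1 :: int) ^ n" and "v = int x ^ n"
    have "(- int x) ^ n = u * v" unfolding u_def v_def by (rule power_minus)
    thus ?thesis
      unfolding power_Suc u_def[symmetric] v_def[symmetric] by (simp add: algebra_simps)
  qed
  have 3: "(- 1) ^ Suc n * (odd_sum p (Suc n) - of_nat (Suc n) * int p * odd_sum p n) =
      (\<Sum>x | x \<in> {1..p - 1} \<and> odd x.
        (- int x) ^ Suc n + of_nat (Suc n) * (- int x) ^ n * 1 * int p)"
    unfolding odd_sum_def sum_distrib_left sum_subtractf[symmetric] 2[symmetric] by (rule refl)
  show ?thesis
    unfolding 1 3
  proof (rule cong_sum)
    fix x assume "x \<in> {x. x \<in> {1..p - 1} \<and> odd x}"
    hence "int (p - x) = - int x + 1 * int p" by (auto simp: of_nat_diff)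
    thus "[int (p - x) ^ Suc n =
        (- int x) ^ Suc n + of_nat (Suc n) * (- int x) ^ n * 1 * int p] (mod (int p)\<^sup>2)"
      by (simp only: power_add_cong_square)
  qed
qed

text \<open>For n < p - 1 the number B_n is p-integral, so p B_n is divisible by p as well.\<close>

lemma power_sum_dvd:
  assumes "n + 1 < p"
  shows "int p dvd (\<Sum>x<p. int x ^ n)"
proof -
  obtain z where z: "z \<in> padic_ints p"
    "(\<Sum>k<p. of_nat k ^ n) = of_nat p * bernoulli n + of_nat (p\<^sup>2) * z"
    using power_sum_padic[of n] assms by auto
  have "of_int (\<Sum>x<p. int x ^ n) = of_nat p * (bernoulli n + of_nat p * z)"
    using z(2) by (simp add: algebra_simps power2_eq_square)
  moreover have "bernoulli n + of_nat p * z \<in> padic_ints p"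
    using z(1) by (intro padic_ints_add padic_ints_mult bernoulli_in_padic_ints[OF assms]) auto
  ultimately show ?thesis by (rule dvd_if_padic)
qed

lemma cong_square_imp_cong: "[a = b] (mod (int p)\<^sup>2) \<Longrightarrow> [a = b] (mod int p)"
  by (rule cong_modulus_mult[of _ _ _ "int p"]) (simp add: power2_eq_square)

lemma coprime_2: "coprime (2 :: int) (int p)" "coprime (2 :: int) ((int p)\<^sup>2)"
  using odd by simp_all

lemma even_sum_cong_neg: "[even_sum p (p - 2) = - odd_sum p (p - 2)] (mod int p)"
proof -
  obtain n where n: "p - 2 = Suc n" "even n" using that[of "p - 3"] ge_3 odd by auto
  have "[even_sum p (p - 2) = - (odd_sum p (p - 2) - of_nat (Suc n) * int p * odd_sum p n)] (mod int p)"
    using cong_square_imp_cong[OF even_sum_cong[of n]] n by simp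
  also have "[- (odd_sum p (p - 2) - of_nat (Suc n) * int p * odd_sum p n) = - odd_sum p (p - 2)] (mod int p)"
    by (simp add: cong_iff_dvd_diff)
  finally show ?thesis .
qed

text \<open>The linear term of the reflection is a multiple of p times
  \<open>odd_sum p (p - 3)\<close>. For the even exponent p - 3 the odd and even sums agree modulo p
  while their total is 0, so p divides that odd sum. For p = 3 the exponent is 0 and this breaks
  down.\<close>

lemma even_sum_cong_neg_square:
  assumes "p \<noteq> 3"
  shows "[even_sum p (p - 2) = - odd_sum p (p - 2)] (mod (int p)\<^sup>2)"
proof -
  have "p \<noteq> 4" using odd by auto
  hence p: "p \<ge> 5" using ge_3 assms by simp
  define n where "n = p - 4"
  have n: "p - 2 = Suc (Suc n)" "p - 3 = Suc n" "odd n" using p odd by (auto simp: n_def)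
  have "[even_sum p (Suc n) = odd_sum p (Suc n) - of_nat (Suc n) * int p * odd_sum p n] (mod int p)"
    using cong_square_imp_cong[OF even_sum_cong[of n]] n by simp
  also have "[odd_sum p (Suc n) - of_nat (Suc n) * int p * odd_sum p n = odd_sum p (Suc n)] (mod int p)"
    by (simp add: cong_iff_dvd_diff)
  finally have "[odd_sum p (Suc n) + even_sum p (Suc n) = odd_sum p (Suc n) + odd_sum p (Suc n)] (mod int p)"
    by (intro cong_add cong_refl)
  moreover have "[odd_sum p (Suc n) + even_sum p (Suc n) = 0] (mod int p)"
    using power_sum_dvd[of "Suc n"] p by (simp add: odd_sum_add_even_sum n_def cong_0_iff)
  ultimately have "[2 * odd_sum p (Suc n) = 0] (mod int p)"
    by (metis cong_sym cong_trans mult_2)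
  hence "int p dvd odd_sum p (Suc n)"
    using coprime_2(1) by (simp add: cong_0_iff coprime_commute coprime_dvd_mult_right_iff)
  hence "(int p)\<^sup>2 dvd of_nat (Suc (Suc n)) * (int p * odd_sum p (Suc n))"
    unfolding power2_eq_square by (intro dvd_mult mult_dvd_mono dvd_refl)
  hence d: "[of_nat (Suc (Suc n)) * int p * odd_sum p (Suc n) = 0] (mod (int p)\<^sup>2)"
    by (simp only: cong_0_iff mult.assoc)
  have "[even_sum p (p - 2) =
      - (odd_sum p (p - 2) - of_nat (Suc (Suc n)) * int p * odd_sum p (Suc n))] (mod (int p)\<^sup>2)"
    using even_sum_cong[of "Suc n"] n by simp
  also have "[- (odd_sum p (p - 2) - of_nat (Suc (Suc n)) * int p * odd_sum p (Suc n)) =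
      - (odd_sum p (p - 2) - 0)] (mod (int p)\<^sup>2)"
    using d by (intro cong_minus_minus_iff[THEN iffD2] cong_diff cong_refl)
  finally show ?thesis by simp
qed

section \<open>Fermat and Wilson quotients\<close>

lemma fermat: "\<not> p dvd x \<Longrightarrow> [int x ^ (p - 1) = 1] (mod int p)"
  using fermat_theorem[OF prime, of x] by (metis cong_int_iff of_nat_1 of_nat_power)

text \<open>By Pascal's rule neighbouring entries add up to \<open>p choose Suc k\<close>, a
  multiple of p.\<close>

lemma binomial_pred_cong: "k < p \<Longrightarrow> [int (p - 1 choose k) = (- 1) ^ k] (mod int p)"
proof (induction k)
  case (Suc k)
  have "p choose Suc k = (p - 1 choose k) + (p - 1 choose Suc k)"
    using ge_3 by (cases p) auto
  moreover have "p dvd p choose Suc k"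
    using Suc.prems prime by (intro dvd_choose_prime) auto
  ultimately have "[int (p - 1 choose k) + int (p - 1 choose Suc k) = 0] (mod int p)"
    by (simp add: cong_0_iff flip: of_nat_add)
  hence "[int (p - 1 choose k) + int (p - 1 choose Suc k) - int (p - 1 choose k) = 0 - (- 1) ^ k] (mod int p)"
    using Suc by (intro cong_diff) auto
  thus ?case by simp
qed simp

text \<open>Here \<open>p choose x\<close> is p / x times \<open>p - 1 choose (x - 1)\<close>, and
  x^(p-2) inverts x modulo p.\<close>

lemma binomial_prime_cong:
  assumes "x \<in> {1..p - 1}"
  shows "[int (p choose x) = int p * ((- 1) ^ Suc x * int x ^ (p - 2))] (mod (int p)\<^sup>2)"
proof -
  have x: "0 < x" "x < p" using assms by auto
  have np: "\<not> p dvd x" using x by (auto dest: dvd_imp_le)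
  have "p dvd p choose x" using x prime by (intro dvd_choose_prime) auto
  then obtain c where c: "p choose x = p * c" by blast
  have "p * (x * c) = p * (p - 1 choose (x - 1))"
    using times_binomial_minus1_eq[OF x(1), of p, unfolded c] by (simp only: mult.left_commute)
  moreover have "p \<noteq> 0" using x by simp
  ultimately have xc: "x * c = (p - 1 choose (x - 1))" by (simp only: mult_cancel1) simp
  have "p - 1 = Suc (p - 2)" using ge_3 by simp
  hence pow: "int x ^ (p - 1) = int x ^ (p - 2) * int x" by (simp only: power_Suc2)
  have "[1 * int c = int x ^ (p - 1) * int c] (mod int p)"
    by (rule cong_mult[OF cong_sym[OF fermat[OF np]] cong_refl])
  also have "int x ^ (p - 1) * int c = int x ^ (p - 2) * int (p - 1 choose (x - 1))"
    using pow by (simp only: xc[symmetric] of_nat_mult mult.assoc)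
  also have "[\<dots> = int x ^ (p - 2) * (- 1) ^ (x - 1)] (mod int p)"
    using x by (intro cong_mult cong_refl binomial_pred_cong) auto
  also have "int x ^ (p - 2) * (- 1) ^ (x - 1) = (- 1) ^ Suc x * int x ^ (p - 2)"
    using x by (cases x) auto
  finally have "[int p * int c = int p * ((- 1) ^ Suc x * int x ^ (p - 2))] (mod int p * int p)"
    unfolding mult_1 by (rule cong_cmult_leftI)
  thus ?thesis by (simp add: c power2_eq_square)
qed

text \<open>In the binomial expansion of 2^p the ends give 2 and the rest gives p (O - E), where E
  is congruent to -O modulo p; then 2 is cancelled. So O represents the Fermat quotient of
  2.\<close>

lemma two_power_cong: "[2 ^ (p - 1) = 1 + int p * odd_sum p (p - 2)] (mod (int p)\<^sup>2)"
proof -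
  have "int p dvd even_sum p (p - 2) + odd_sum p (p - 2)"
    using even_sum_cong_neg by (simp add: cong_iff_dvd_diff)
  then obtain c where "even_sum p (p - 2) + odd_sum p (p - 2) = int p * c" by blast
  hence c: "odd_sum p (p - 2) - even_sum p (p - 2) = 2 * odd_sum p (p - 2) - int p * c" by simp
  have "{..p} = insert 0 (insert p {1..p - 1})" using ge_3 by auto
  moreover have "(2 :: int) ^ p = (\<Sum>x\<le>p. int (p choose x))"
    by (simp flip: of_nat_sum choose_row_sum)
  ultimately have "2 ^ p = 2 + (\<Sum>x\<in>{1..p - 1}. int (p choose x))" using ge_3 by simp
  also have "[\<dots> = 2 + (\<Sum>x\<in>{1..p - 1}. int p * ((- 1) ^ Suc x * int x ^ (p - 2)))] (mod (int p)\<^sup>2)"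
    by (intro cong_add cong_sum cong_refl binomial_prime_cong)
  also have "2 + (\<Sum>x\<in>{1..p - 1}. int p * ((- 1) ^ Suc x * int x ^ (p - 2))) =
      2 + int p * (odd_sum p (p - 2) - even_sum p (p - 2))"
    unfolding sum_distrib_left[symmetric] sum_split_parity
    by (simp add: odd_sum_def even_sum_def sum_negf)
  also have "[\<dots> = 2 * (1 + int p * odd_sum p (p - 2))] (mod (int p)\<^sup>2)"
    unfolding c by (simp add: cong_iff_dvd_diff algebra_simps power2_eq_square)
  also have "2 ^ p = 2 * (2 :: int) ^ (p - 1)" using ge_3 by (simp flip: power_Suc)
  finally show ?thesis by (simp only: cong_mult_lcancel[OF coprime_2(2)])
qed

text \<open>Reflection with the even exponent p - 1; the factor -(p - 1) p is congruent to
  p.\<close>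

lemma power_sum_cong_odd_sum:
  "[(\<Sum>x<p. int x ^ (p - 1)) = 2 * odd_sum p (p - 1) + int p * odd_sum p (p - 2)] (mod (int p)\<^sup>2)"
proof -
  have n: "p - 1 = Suc (p - 2)" using ge_3 by simp
  have e: "even (Suc (p - 2))" using odd ge_3 by auto
  have "[even_sum p (p - 1) =
      odd_sum p (p - 1) - int (Suc (p - 2)) * int p * odd_sum p (p - 2)] (mod (int p)\<^sup>2)"
    using even_sum_cong[of "p - 2"] e unfolding n by simp
  also have "[odd_sum p (p - 1) - int (Suc (p - 2)) * int p * odd_sum p (p - 2) =
      odd_sum p (p - 1) + int p * odd_sum p (p - 2)] (mod (int p)\<^sup>2)"
    using ge_3 unfolding n[symmetric]
    by (simp add: cong_iff_dvd_diff algebra_simps power2_eq_square of_nat_diff)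
  finally have "[odd_sum p (p - 1) + even_sum p (p - 1) =
      odd_sum p (p - 1) + (odd_sum p (p - 1) + int p * odd_sum p (p - 2))] (mod (int p)\<^sup>2)"
    by (intro cong_add cong_refl)
  thus ?thesis using odd_sum_add_even_sum[of "p - 1"] ge_3 by (simp add: algebra_simps)
qed

text \<open>Lerch's argument: (p - 1)!^(p-1) is the product of all x^(p-1) = 1 + p q(x), and also
  (-1 + p W)^(p-1) with the Wilson quotient W. First-order terms show that p W is congruent to p
  times the sum of the q(x).\<close>

lemma fact_pred_cong: "[fact (p - 1) = (\<Sum>x<p. int x ^ (p - 1)) - int p] (mod (int p)\<^sup>2)"
proof -
  define q where "q x = (int x ^ (p - 1) - 1) div int p" for x
  have q: "int x ^ (p - 1) = 1 + int p * q x" if "x \<in> {1..p - 1}" for x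
  proof -
    have "\<not> p dvd x" using that by (auto dest: dvd_imp_le)
    hence "int p dvd int x ^ (p - 1) - 1" using fermat by (simp add: cong_iff_dvd_diff)
    thus ?thesis by (simp add: q_def)
  qed
  have "{..<p} = insert 0 {1..p - 1}" using ge_3 by auto
  hence S: "(\<Sum>x<p. int x ^ (p - 1)) = int p - 1 + int p * (\<Sum>x\<in>{1..p - 1}. q x)"
    using ge_3 by (simp add: q sum.distrib sum_distrib_left[symmetric] of_nat_diff zero_power
        del: One_nat_def)
  have "int p dvd fact (p - 1) + 1"
    using wilson_theorem[OF prime] by (simp add: cong_iff_dvd_diff)
  then obtain W where "fact (p - 1) + 1 = int p * W" by blast
  hence W: "fact (p - 1) = - 1 + W * int p" by (simp add: algebra_simps)
  have n: "p - 1 = Suc (p - 2)" using ge_3 by simp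
  have o: "odd (p - 2)" using odd ge_3 by auto
  have "[1 + int p * (\<Sum>x\<in>{1..p - 1}. q x) = (\<Prod>x\<in>{1..p - 1}. 1 + int p * q x)] (mod (int p)\<^sup>2)"
    by (rule cong_sym[OF prod_one_plus_cong_square])
  also have "(\<Prod>x\<in>{1..p - 1}. 1 + int p * q x) = (- 1 + W * int p) ^ (p - 1)"
    unfolding W[symmetric] fact_prod by (simp add: q[symmetric] prod_power_distrib)
  also have "[\<dots> = (- 1) ^ Suc (p - 2) + of_nat (Suc (p - 2)) * (- 1) ^ (p - 2) * W * int p] (mod (int p)\<^sup>2)"
    unfolding n by (rule power_add_cong_square)
  also have "(- 1) ^ Suc (p - 2) + of_nat (Suc (p - 2)) * (- 1) ^ (p - 2) * W * int p =
      1 + W * int p - W * int p * int p"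
    using o n ge_3 by (simp add: algebra_simps of_nat_diff)
  also have "[\<dots> = 1 + W * int p] (mod (int p)\<^sup>2)"
    by (simp add: cong_iff_dvd_diff power2_eq_square)
  finally have "[1 + int p * (\<Sum>x\<in>{1..p - 1}. q x) - 2 = 1 + W * int p - 2] (mod (int p)\<^sup>2)"
    by (intro cong_diff cong_refl)
  from cong_sym[OF this] show ?thesis unfolding S W by (simp add: algebra_simps)
qed

text \<open>The modulus stays open: it will be p for every odd p, and its square when p is not
  3.\<close>

lemma two_power_mult_odd_sum_cong:
  assumes "[even_sum p (p - 2) = - odd_sum p (p - 2)] (mod m)" "m dvd (int p)\<^sup>2"
    "[2 ^ (p - 1) * (odd_sum p (p - 2) - even_sum p (p - 2)) = 2 * alt_int (p - 2)] (mod m)"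
  shows "[odd_sum p (p - 2) + int p * (odd_sum p (p - 2))\<^sup>2 = alt_int (p - 2)] (mod m)"
proof -
  let ?O = "odd_sum p (p - 2)" and ?E = "even_sum p (p - 2)"
  have cop: "coprime 2 m"
    using coprime_2(2) assms(2) by (metis coprime_divisors dvd_refl)
  have "[2 * ((1 + int p * ?O) * ?O) = (1 + int p * ?O) * (?O - (- ?O))] (mod m)"
    by (simp add: algebra_simps)
  also have "[(1 + int p * ?O) * (?O - (- ?O)) = 2 ^ (p - 1) * (?O - ?E)] (mod m)"
    by (rule cong_sym[OF cong_mult[OF cong_dvd_modulus[OF two_power_cong assms(2)]
          cong_diff[OF cong_refl assms(1)]]])
  also note assms(3)
  finally have "[(1 + int p * ?O) * ?O = alt_int (p - 2)] (mod m)"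
    by (simp only: cong_mult_lcancel[OF cop])
  thus ?thesis by (simp add: algebra_simps power2_eq_square)
qed

text \<open>Valid for p = 3 too, which part (ii) requires; there the odd sum occurs only with a
  factor p.\<close>

lemma odd_sum_cong_alt:
  "[odd_sum p (p - 2) = alt_int (p - 2)] (mod int p)"
proof -
  have n: "Suc (p - 2) = p - 1" "int p dvd int p ^ (p - 2)" using ge_3 by (auto intro: dvd_power)
  have "[2 ^ (p - 1) * (odd_sum p (p - 2) - even_sum p (p - 2)) =
      2 ^ (p - 1) * (odd_sum p (p - 2) - even_sum p (p - 2) + int p ^ (p - 2))] (mod int p)"
    using n by (simp add: cong_iff_dvd_diff algebra_simps)
  also have "[2 ^ (p - 1) * (odd_sum p (p - 2) - even_sum p (p - 2) + int p ^ (p - 2)) =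
      2 * alt_int (p - 2)] (mod int p)"
    using alternating_power_sum_cong[OF odd, of "p - 2"] unfolding alternating_sum_eq n .
  finally have "[odd_sum p (p - 2) + int p * (odd_sum p (p - 2))\<^sup>2 = alt_int (p - 2)] (mod int p)"
    by (rule two_power_mult_odd_sum_cong[OF even_sum_cong_neg, rotated]) simp
  moreover have "[odd_sum p (p - 2) + int p * (odd_sum p (p - 2))\<^sup>2 = odd_sum p (p - 2)] (mod int p)"
    by (simp add: cong_iff_dvd_diff)
  ultimately show ?thesis by (metis cong_sym cong_trans)
qed

lemma odd_sum_cong_alt_square:
  assumes "p \<noteq> 3"
  shows "[odd_sum p (p - 2) + int p * (odd_sum p (p - 2))\<^sup>2 = alt_int (p - 2)] (mod (int p)\<^sup>2)"
proof -
  have "p \<noteq> 4" using odd by auto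
  hence p: "p \<ge> 5" using ge_3 assms by simp
  have n: "Suc (p - 2) = p - 1" using ge_3 by auto
  have d: "(int p)\<^sup>2 dvd int p ^ (p - 2)" using p by (intro le_imp_power_dvd) simp
  have "[2 ^ (p - 1) * (odd_sum p (p - 2) - even_sum p (p - 2)) =
      2 ^ (p - 1) * (odd_sum p (p - 2) - even_sum p (p - 2) + int p ^ (p - 2))] (mod (int p)\<^sup>2)"
    using d by (simp add: cong_iff_dvd_diff algebra_simps)
  also have "[2 ^ (p - 1) * (odd_sum p (p - 2) - even_sum p (p - 2) + int p ^ (p - 2)) =
      2 * alt_int (p - 2)] (mod (int p)\<^sup>2)"
    using alternating_power_sum_cong_square[OF odd, of "p - 2"] odd p
    unfolding alternating_sum_eq n by simp
  finally show ?thesis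
    by (rule two_power_mult_odd_sum_cong[OF even_sum_cong_neg_square[OF assms], rotated]) simp
qed

text \<open>(p - 1)! is divided by p - 1, whose inverse modulo p^2 is -(1 + p).\<close>

lemma fact_p_minus_2_cong:
  assumes "(\<Sum>x<p. int x ^ (p - 1)) = - 1 + int p * c"
  shows "[fact (p - 2) = 1 + int p * (2 - c)] (mod (int p)\<^sup>2)"
proof -
  have f: "fact (p - 1) = (int p - 1) * fact (p - 2)"
  proof -
    have "p - 1 = Suc (p - 2)" "int (Suc (p - 2)) = int p - 1" using ge_3 by auto
    thus ?thesis by (simp only: fact_Suc)
  qed
  have "[fact (p - 2) = - (1 + int p) * fact (p - 1)] (mod (int p)\<^sup>2)"
    unfolding f by (simp add: cong_iff_dvd_diff algebra_simps power2_eq_square)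
  also have "[- (1 + int p) * fact (p - 1) = - (1 + int p) * (- 1 + int p * c - int p)] (mod (int p)\<^sup>2)"
    using fact_pred_cong unfolding assms by (intro cong_mult cong_refl)
  also have "[- (1 + int p) * (- 1 + int p * c - int p) = 1 + int p * (2 - c)] (mod (int p)\<^sup>2)"
    unfolding cong_iff_dvd_diff dvd_def
    by (rule exI[of _ "1 - c"]) (simp add: algebra_simps power2_eq_square)
  finally show ?thesis .
qed

text \<open>Gives an integer \<open>c\<close> congruent to the quotient modulo p. This precision
  suffices, as the quotient enters the final formulas multiplied by p.\<close>

lemma agoh_giuga_quotient_padic:
  obtains c z where "(\<Sum>x<p. int x ^ (p - 1)) = - 1 + int p * c" "z \<in> padic_ints p"
    "agoh_giuga_quotient p = of_int c - of_nat p * z"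
proof -
  obtain z where z: "z \<in> padic_ints p"
    "(\<Sum>k<p. of_nat k ^ (p - 1)) = of_nat p * bernoulli (p - 1) + of_nat (p\<^sup>2) * z"
    using power_sum_padic[of "p - 1"] ge_3 by auto
  have "[- 1 = (\<Sum>x<p. int x ^ (p - 1)) - int p] (mod int p)"
    using cong_square_imp_cong[OF fact_pred_cong] wilson_theorem[OF prime]
    by (metis cong_sym cong_trans)
  hence "[(\<Sum>x<p. int x ^ (p - 1)) - int p = - 1] (mod int p)" by (rule cong_sym)
  hence "int p dvd (\<Sum>x<p. int x ^ (p - 1)) + 1 - int p"
    by (simp add: cong_iff_dvd_diff algebra_simps)
  hence "int p dvd (\<Sum>x<p. int x ^ (p - 1)) + 1" by (simp add: dvd_diff_left_iff)
  then obtain c where "(\<Sum>x<p. int x ^ (p - 1)) + 1 = int p * c" by blast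
  hence c: "(\<Sum>x<p. int x ^ (p - 1)) = - 1 + int p * c" by simp
  have "of_int (\<Sum>x<p. int x ^ (p - 1)) = of_nat p * bernoulli (p - 1) + of_nat (p\<^sup>2) * z"
    using z(2) by simp
  hence "of_nat p * bernoulli (p - 1) + 1 = of_nat p * (of_int c - of_nat p * z)"
    unfolding c by (simp add: algebra_simps power2_eq_square)
  hence "agoh_giuga_quotient p = of_int c - of_nat p * z"
    using ge_3 by (simp add: agoh_giuga_quotient_def)
  with that c z(1) show thesis by blast
qed

section \<open>Transfer from integer to p-adic congruences\<close>

lemma padic_congI:
  assumes "[a = b] (mod (int p)\<^sup>2)" "z \<in> padic_ints p" "y = of_int b + of_nat (p\<^sup>2) * z"
  shows "padic_cong p (of_int a) y (p\<^sup>2)"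
proof -
  obtain k where "a - b = (int p)\<^sup>2 * k"
    using assms(1) by (auto simp: cong_iff_dvd_diff)
  hence "(of_int (a - b) :: rat) = of_int ((int p)\<^sup>2 * k)" by (simp only:)
  hence "of_int a - y = of_nat (p\<^sup>2) * (of_int k - z)"
    using assms(3) by (simp add: algebra_simps)
  moreover have "of_int k - z \<in> padic_ints p" using assms(2) by auto
  moreover have "y \<in> padic_ints p" unfolding assms(3)
    by (intro padic_ints_add padic_ints_mult int_in_padic_ints nat_in_padic_ints assms(2))
  ultimately show ?thesis unfolding padic_cong_def by auto
qed

lemma of_int_odd_sum: "of_int (odd_sum p n) = (\<Sum>x | x \<in> {1..p - 1} \<and> odd x. of_nat x ^ n :: rat)"
  by (simp add: odd_sum_def)

end

text \<open>At p = 3 the first congruence fails: N = 1, \<open>d0 = 2\<close>, \<open>d1 = 0\<close>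
  and A = 1/2 give 1 on the left and -13/2 on the right, with difference 15/2. Hence the restriction
  there.\<close>

theorem theorem8:
  fixes p :: nat and A :: rat and N d0 d1 :: nat
  assumes "prime p" and "odd p"
    and "N = num_even_ascents (p - 2)"
    and "d0 = padic_digit p (of_nat (2 * N)) 0"
    and "d1 = padic_digit p (of_nat (2 * N)) 1"
    and "A = agoh_giuga_quotient p"
  shows "A \<in> padic_ints p \<and>
    (p \<noteq> 3 \<longrightarrow>
       padic_cong p (\<Sum>x | x \<in> {1..p - 1} \<and> odd x. of_nat x ^ (p - 2))
         (of_nat d0 - 1 + of_nat p * (A + of_nat d1 - (of_nat d0 - 1)\<^sup>2 - 2)) (p\<^sup>2)) \<and>
    padic_cong p (\<Sum>x | x \<in> {1..p - 1} \<and> odd x. of_nat x ^ (p - 1))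
      (- 1 / 2 + of_nat p / 2 * (A - of_nat d0 + 1)) (p\<^sup>2)"
proof -
  interpret odd_prime p using assms(1,2) by unfold_locales
  let ?O = "odd_sum p (p - 2)" and ?O' = "odd_sum p (p - 1)"
  obtain c z where S: "(\<Sum>x<p. int x ^ (p - 1)) = - 1 + int p * c"
    and z: "z \<in> padic_ints p" and A: "A = of_int c - of_nat p * z"
    using agoh_giuga_quotient_padic assms(6) by metis
  have "2 * N mod p\<^sup>2 = d0 + d1 * p"
    using digit_sum_mod[of "2 * N" p 2] unfolding assms(4,5) padic_digit_of_nat[OF assms(1)]
    by (simp add: numeral_2_eq_2)
  hence "[int (2 * N) = int d0 + int d1 * int p] (mod (int p)\<^sup>2)"
    by (metis cong_int_iff cong_mod_left cong_refl cong_sym of_nat_add of_nat_mult of_nat_power)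
  hence alt: "[alt_int (p - 2) = int d0 + int d1 * int p - (1 + int p * (2 - c))] (mod (int p)\<^sup>2)"
    unfolding alt_int_def assms(3)[symmetric] using fact_p_minus_2_cong[OF S]
    by (intro cong_diff) auto
  have "[int d0 + int d1 * int p - (1 + int p * (2 - c)) = int d0 - 1] (mod int p)"
    by (simp add: cong_iff_dvd_diff)
  hence O: "[?O = int d0 - 1] (mod int p)"
    using odd_sum_cong_alt cong_square_imp_cong[OF alt] by (metis cong_trans)
  have pO: "[int p * ?O = int p * (int d0 - 1)] (mod (int p)\<^sup>2)"
    using O unfolding power2_eq_square by (rule cong_cmult_leftI)
  \<comment> \<open>The factor p lifts knowledge of \<open>?O\<close> modulo p to modulus
    p^2.\<close>
  have pO2: "[int p * ?O\<^sup>2 = int p * (int d0 - 1)\<^sup>2] (mod (int p)\<^sup>2)"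
    using cong_pow[OF O, of 2] unfolding power2_eq_square[of "int p"] by (rule cong_cmult_leftI)
  have "padic_cong p (of_int ?O)
      (of_nat d0 - 1 + of_nat p * (A + of_nat d1 - (of_nat d0 - 1)\<^sup>2 - 2)) (p\<^sup>2)" if "p \<noteq> 3"
  proof (rule padic_congI)
    have "[?O = ?O + int p * ?O\<^sup>2 - int p * ?O\<^sup>2] (mod (int p)\<^sup>2)" by simp
    also have "[?O + int p * ?O\<^sup>2 - int p * ?O\<^sup>2 =
        int d0 + int d1 * int p - (1 + int p * (2 - c)) - int p * (int d0 - 1)\<^sup>2] (mod (int p)\<^sup>2)"
      using cong_trans[OF odd_sum_cong_alt_square[OF that] alt] pO2 by (rule cong_diff)
    finally show "[?O = int d0 + int d1 * int p - (1 + int p * (2 - c)) -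
        int p * (int d0 - 1)\<^sup>2] (mod (int p)\<^sup>2)" .
    show "- z \<in> padic_ints p" using z by auto
    show "of_nat d0 - 1 + of_nat p * (A + of_nat d1 - (of_nat d0 - 1)\<^sup>2 - 2) =
        of_int (int d0 + int d1 * int p - (1 + int p * (2 - c)) - int p * (int d0 - 1)\<^sup>2) +
        of_nat (p\<^sup>2) * - z"
      by (simp add: A algebra_simps power2_eq_square)
  qed
  moreover have "padic_cong p (of_int ?O') (- 1 / 2 + of_nat p / 2 * (A - of_nat d0 + 1)) (p\<^sup>2)"
  proof -
    have "[2 * ?O' + int p * ?O - int p * ?O = - 1 + int p * c - int p * (int d0 - 1)] (mod (int p)\<^sup>2)"
      using cong_sym[OF power_sum_cong_odd_sum] pO unfolding S by (rule cong_diff)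
    hence "[2 * ?O' = - 1 + int p * (c - int d0 + 1)] (mod (int p)\<^sup>2)"
      by (simp add: algebra_simps)
    then obtain k where "2 * ?O' - (- 1 + int p * (c - int d0 + 1)) = (int p)\<^sup>2 * k"
      by (auto simp: cong_iff_dvd_diff)
    hence "2 * ?O' = - 1 + int p * (c - int d0 + 1) + (int p)\<^sup>2 * k" by simp
    hence "(of_int (2 * ?O') :: rat) = of_int (- 1 + int p * (c - int d0 + 1) + (int p)\<^sup>2 * k)"
      by (simp only:)
    \<comment> \<open>Halving is harmless because 2 is prime to p; the error collects
      \<open>k\<close> from the congruence and \<open>z\<close> from A.\<close>
    hence "- 1 / 2 + of_nat p / 2 * (A - of_nat d0 + 1) =
        of_int ?O' + of_nat (p\<^sup>2) * (- (of_int k + z) / of_nat 2)"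
      by (simp add: A field_simps power2_eq_square)
    moreover have "\<not> p dvd 2" using ge_3 by (auto dest: dvd_imp_le)
    hence "- (of_int k + z) / of_nat 2 \<in> padic_ints p"
      using z by (intro padic_ints_divide padic_ints_minus padic_ints_add) auto
    ultimately show ?thesis by (intro padic_congI[OF cong_refl])
  qed
  moreover have "A \<in> padic_ints p" unfolding A
    by (intro padic_ints_diff padic_ints_mult int_in_padic_ints nat_in_padic_ints z)
  ultimately show ?thesis unfolding of_int_odd_sum by blast
qed

end
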